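(* Let $D>0$ and $A$ be reals with $D\le A<2D$. Let $n$ be a positive integer with standard binary expansion $N_{\mathcal B}=n_\lambda\dots n_0$, $n_\lambda=1$, and let $N^*=n^*_{\lambda+1}\dots n^*_0$ be the output of Algorithm 3 on $N_{\mathcal B}$ with parameter $\alpha=A/D$. Then $N^*$ is a canonical representation of $n$, and $T(N^*,\lambda+1)\le T(M,\lambda+1)$ for every canonical representation $M=m_{\lambda+1}\dots m_0$ of $n$.
   Context: A canonical representation of $n$ is a string $m_\mu\dots m_0$ with $m_i\in\{-1,0,1\}$ and $\sum_i m_i2^i=n$ (written most significant digit first). Time model: for a digit string $N=n_\lambda\dots n_0$, define recursively for $0\le i\le\lambda$: $T(N,i)=0$ if $i=0$ and $n_0=0$; $T(N,i)=T(N,i-1)$ if $i>0$ and $n_i=0$; $T(N,i)=iD+(|n_i|-1)A$ if $n_i\ne0$ and $n_j=0$ for all $0\le j<i$; and $T(N,i)=\max(T(N,i-1),iD)+|n_i|A$ otherwise. Algorithm 3 (parameter $\alpha$): input $N_{\mathcal B}=n_\lambda\dots n_0$. Set $n'_j\leftarrow n_j$ for $j\le\lambda$, $n'_{\lambda+1}\leftarrow0$, $\ell\leftarrow$ index of the least significant $1$, $d\leftarrow0$. For $i=\ell+1,\dots,\lambda+1$ in order: if $n'_i=1$, set $d\leftarrow\max(d+(\alpha-1),\alpha)$; otherwise set $d\leftarrow d-1$, and then if $d>\alpha$: set $n'_\ell\leftarrow-1$, $n'_j\leftarrow n'_j-1$ for all $\ell<j<i$, $n'_i\leftarrow1$, $d\leftarrow\alpha$,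 $\ell\leftarrow i$; else if $d\le1$: set $\ell\leftarrow i+1$. Return $n'_{\lambda+1}\dots n'_0$. *)

theory Defs
  imports Complex_Main
begin

text \<open>
  A digit string \<open>m\<^sub>\<mu> \<dots> m\<^sub>0\<close> is given by its top index \<open>\<mu>\<close> and a function \<open>m :: nat \<Rightarrow> int\<close>
  of which only the values \<open>m i\<close> with \<open>i \<le> \<mu>\<close> matter.
\<close>

definition digit_value :: "nat \<Rightarrow> (nat \<Rightarrow> int) \<Rightarrow> int" where
  "digit_value \<mu> m = (\<Sum>i\<le>\<mu>. m i * 2 ^ i)"

definition canonical_rep :: "int \<Rightarrow> nat \<Rightarrow> (nat \<Rightarrow> int) \<Rightarrow> bool" where
  "canonical_rep n \<mu> m \<longleftrightarrow> (\<forall>i\<le>\<mu>. m i \<in> {-1, 0, 1}) \<and> digit_value \<mu> m = n"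

definition binary_expansion :: "int \<Rightarrow> nat \<Rightarrow> (nat \<Rightarrow> int) \<Rightarrow> bool" where
  "binary_expansion n \<nu> N \<longleftrightarrow>
     (\<forall>i\<le>\<nu>. N i \<in> {0, 1}) \<and> N \<nu> = 1 \<and> digit_value \<nu> N = n"

fun comp_time :: "real \<Rightarrow> real \<Rightarrow> (nat \<Rightarrow> int) \<Rightarrow> nat \<Rightarrow> real" where
  "comp_time D A N i =
    (if i = 0 \<and> N 0 = 0 then 0
     else if i > 0 \<and> N i = 0 then comp_time D A N (i - 1)
     else if N i \<noteq> 0 \<and> (\<forall>j<i. N j = 0) then
       real i * D + (real_of_int \<bar>N i\<bar> - 1) * A
     else max (comp_time D A N (i - 1)) (real i * D) + real_of_int \<bar>N i\<bar> * A)"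

text \<open>The defining equation is unconditional, so it would loop as a rewrite rule.\<close>

declare comp_time.simps [simp del]

text \<open>The loop state is \<open>(n', \<ell>, d)\<close>.\<close>

type_synonym alg_state = "(nat \<Rightarrow> int) \<times> nat \<times> real"

definition alg3_step :: "real \<Rightarrow> nat \<Rightarrow> alg_state \<Rightarrow> alg_state" where
  "alg3_step \<alpha> i = (\<lambda>(n', l, d).
     if n' i = 1 then (n', l, max (d + (\<alpha> - 1)) \<alpha>)
     else
       (let d' = d - 1 in
        if d' > \<alpha> then
          ((\<lambda>j. if j = l then -1
                else if l < j \<and> j < i then n' j - 1
                else if j = i then 1
                else n' j), i, \<alpha>)
        else if d' \<le> 1 then (n', i + 1, d')
        else (n', l, d')))"

definition lowest_one :: "nat \<Rightarrow> (nat \<Rightarrow> int) \<Rightarrow> nat" where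
  "lowest_one \<nu> N = (LEAST j. j \<le> \<nu> \<and> N j = 1)"

definition alg3_init :: "nat \<Rightarrow> (nat \<Rightarrow> int) \<Rightarrow> alg_state" where
  "alg3_init \<nu> N = ((\<lambda>j. if j \<le> \<nu> then N j else 0), lowest_one \<nu> N, 0)"

text \<open>
  The bounds of the loop are determined before it is entered: it runs through
  \<open>i = \<ell> + 1, \<dots>, \<nu> + 1\<close> for the initial \<open>\<ell>\<close>, although \<open>\<ell>\<close> changes in the body.
\<close>

definition alg3 :: "real \<Rightarrow> nat \<Rightarrow> (nat \<Rightarrow> int) \<Rightarrow> (nat \<Rightarrow> int)" where
  "alg3 \<alpha> \<nu> N =
     fst (fold (alg3_step \<alpha>) [lowest_one \<nu> N + 1 ..< \<nu> + 2] (alg3_init \<nu> N))"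

end

theory Submission
  imports Defs
begin

text \<open>
  Reading digits from the least significant end, a prefix of a canonical representation has the
  value of the binary prefix either exactly (carry 0) or minus \<open>2^(i+1)\<close> (carry 1).  The variable
  \<open>d\<close> of the algorithm turns out to be the minimal time of a carry-0 prefix, measured in units of
  \<open>D\<close> relative to the index \<open>i\<close>.

  Lower bound: a carry-0 prefix can come from a carry-1 prefix only by a nonzero digit over a
  binary 0, which costs at least \<open>\<alpha>\<close>; otherwise the time evolves exactly as \<open>d\<close> does.

  Attained: besides the current string, consider the carry-1 string obtained by borrowing at \<open>\<ell>\<close>,
  with relative time at most \<open>e\<close>.  The inequality \<open>d + e \<le> \<alpha> + 2\<close> is invariant, so when the
  algorithm switches (\<open>d - 1 > \<alpha>\<close>), \<open>e < 1\<close> and the new top digit is not delayed: the new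
  time is exactly \<open>\<alpha>\<close>.
\<close>

section \<open>Values and times of digit strings\<close>

lemma digit_value_0 [simp]: "digit_value 0 m = m 0"
  and digit_value_Suc [simp]: "digit_value (Suc i) m = digit_value i m + m (Suc i) * 2 ^ Suc i"
  by (simp_all add: digit_value_def)

lemma digit_value_cong: "(\<And>j. j \<le> i \<Longrightarrow> m j = m' j) \<Longrightarrow> digit_value i m = digit_value i m'"
  by (simp add: digit_value_def)

lemma digit_value_zero: "(\<And>j. j \<le> i \<Longrightarrow> m j = 0) \<Longrightarrow> digit_value i m = 0"
  by (simp add: digit_value_def)

lemma abs_digit_value_less:
  assumes "\<And>j. j \<le> i \<Longrightarrow> \<bar>m j\<bar> \<le> 1"
  shows "\<bar>digit_value i m\<bar> < 2 ^ Suc i"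
  using assms
proof (induction i)
  case 0
  then show ?case using 0[of 0] by simp
next
  case (Suc i)
  have "\<bar>digit_value i m\<bar> < 2 ^ Suc i" using Suc by simp
  moreover have "\<bar>m (Suc i) * 2 ^ Suc i\<bar> \<le> 2 ^ Suc i"
    using Suc.prems[of "Suc i"] by (simp add: abs_mult)
  ultimately show ?case by simp
qed

lemma comp_time_zero: "m (Suc i) = 0 \<Longrightarrow> comp_time D A m (Suc i) = comp_time D A m i"
  by (subst comp_time.simps) simp

lemma comp_time_first:
  "\<bar>m i\<bar> = 1 \<Longrightarrow> (\<And>j. j < i \<Longrightarrow> m j = 0) \<Longrightarrow> comp_time D A m i = real i * D"
  by (subst comp_time.simps) auto

lemma comp_time_next:
  assumes "\<bar>m (Suc i)\<bar> = 1" and "j \<le> i" and "m j \<noteq> 0"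
  shows "comp_time D A m (Suc i) = max (comp_time D A m i) (real (Suc i) * D) + A"
  using assms by (subst comp_time.simps) (auto simp: less_Suc_eq_le)

text \<open>Equality can fail only at the lowest nonzero digit, where the addition is saved;
  dropping that case distinction costs at most \<open>A\<close>.\<close>

lemma comp_time_le:
  assumes "\<bar>m (Suc i)\<bar> = 1" and "0 \<le> A"
  shows "comp_time D A m (Suc i) \<le> max (comp_time D A m i) (real (Suc i) * D) + A"
proof (cases "\<exists>j\<le>i. m j \<noteq> 0")
  case True
  then show ?thesis using comp_time_next[of m i] assms(1) by fastforce
next
  case False
  then have "comp_time D A m (Suc i) = real (Suc i) * D"
    using assms(1) by (intro comp_time_first) (auto simp: less_Suc_eq_le)
  then show ?thesis using assms(2) by linarith
qed

lemma comp_time_cong: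
  "(\<And>j. j \<le> i \<Longrightarrow> m j = m' j) \<Longrightarrow> comp_time D A m i = comp_time D A m' i"
proof (induction i)
  case 0
  then show ?case by (simp add: comp_time.simps)
next
  case (Suc i)
  then show ?case
    by (subst (1 2) comp_time.simps) (auto simp: less_Suc_eq_le)
qed

text \<open>The digits are lowered at every index above \<open>l\<close>, without an upper end, so
  that one function supplies the carry-1 string for all prefix lengths.\<close>

definition borrow :: "(nat \<Rightarrow> int) \<Rightarrow> nat \<Rightarrow> nat \<Rightarrow> int" where
  "borrow m l j = (if j = l then -1 else if l < j then m j - 1 else m j)"

text \<open>Turning 1 into -1 at \<open>l\<close> loses \<open>2 ^ (l + 1)\<close>, and lowering the
  digits from \<open>l + 1\<close> to \<open>i\<close> loses
  \<open>2 ^ (l + 1) + ... + 2 ^ i\<close>; the sum telescopes.\<close>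

lemma digit_value_borrow:
  assumes "l \<le> i" and "m l = 1"
  shows "digit_value i (borrow m l) = digit_value i m - 2 ^ Suc i"
  using assms(1)
proof (induction i rule: dec_induct)
  case base
  show ?case
  proof (cases l)
    case 0
    then show ?thesis using assms(2) by (simp add: borrow_def)
  next
    case (Suc k)
    have "digit_value k (borrow m l) = digit_value k m"
      using Suc by (intro digit_value_cong) (simp add: borrow_def)
    moreover have "borrow m l l = -1" by (simp add: borrow_def)
    ultimately show ?thesis using Suc assms(2) by simp
  qed
next
  case (step i)
  then show ?case by (simp add: borrow_def algebra_simps)
qed

section \<open>Binary prefixes, and times in units of \<open>D\<close> relative to the index\<close>

locale add_chain =
  fixes D A \<alpha> :: real and B :: "nat \<Rightarrow> int" and k :: nat
  assumes D: "0 < D" and A: "A = \<alpha> * D" and \<alpha>: "1 \<le> \<alpha>" "\<alpha> < 2"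
    and bits: "B j \<in> {0, 1}"
    and first: "B k = 1" "j < k \<Longrightarrow> B j = 0"
begin

lemma A_nonneg: "0 \<le> A"
  using D A \<alpha> by simp

lemma comp_time_le_scaled:
  assumes "\<bar>m (Suc i)\<bar> = 1" and "comp_time D A m i \<le> (real i + c) * D"
  shows "comp_time D A m (Suc i) \<le> (real (Suc i) + (max (c - 1) 0 + \<alpha>)) * D"
proof -
  have "comp_time D A m (Suc i) \<le> max ((real i + c) * D) (real (Suc i) * D) + A"
    using comp_time_le[of m i A D] A_nonneg assms by linarith
  also have "max ((real i + c) * D) (real (Suc i) * D) = max (real i + c) (real (Suc i)) * D"
    using D by (simp add: max_mult_distrib_right)
  also have "max (real i + c) (real (Suc i)) = real (Suc i) + max (c - 1) 0"
    by (simp add: max_def)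
  finally show ?thesis using A by (simp add: algebra_simps)
qed

lemma comp_time_zero_scaled:
  assumes "m (Suc i) = 0" and "comp_time D A m i \<le> (real i + c) * D"
  shows "comp_time D A m (Suc i) \<le> (real (Suc i) + (c - 1)) * D"
  using assms by (simp add: comp_time_zero)

lemma digit_value_first: "digit_value k B = 2 ^ k"
proof (cases k)
  case 0
  then show ?thesis using first by simp
next
  case (Suc k')
  then have "digit_value k' B = 0" using first by (intro digit_value_zero) simp
  then show ?thesis using first(1) Suc by simp
qed

lemma digit_value_bits:
  assumes "k \<le> i"
  shows "0 < digit_value i B"
  using assms
proof (induction i rule: dec_induct)
  case base
  show ?case by (simp add: digit_value_first)
next
  case (step i)
  then show ?case using bits[of "Suc i"] by (auto intro: add_pos_pos)
qed

lemma digit_value_bits_less: "digit_value i B < 2 ^ Suc i"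
proof -
  have "\<bar>B j\<bar> \<le> 1" for j using bits[of j] by auto
  then have "\<bar>digit_value i B\<bar> < 2 ^ Suc i" by (rule abs_digit_value_less)
  then show ?thesis by linarith
qed

section \<open>Lower bound for carry-0 prefixes\<close>

definition lower_bound :: "nat \<Rightarrow> real \<Rightarrow> bool" where
  "lower_bound i d \<longleftrightarrow>
     (\<forall>M. (\<forall>j\<le>i. \<bar>M j\<bar> \<le> 1) \<longrightarrow> digit_value i M = digit_value i B \<longrightarrow>
        (real i + d) * D \<le> comp_time D A M i)"

text \<open>Digits below \<open>k\<close> total less than \<open>2 ^ k\<close> in absolute value, so
  digit \<open>k\<close> must be nonzero, and its own delay is already \<open>k * D\<close>.\<close>

lemma lower_bound_first: "lower_bound k 0"
  unfolding lower_bound_def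
proof (intro allI impI)
  fix M assume M: "\<forall>j\<le>k. \<bar>M j\<bar> \<le> 1" and eq: "digit_value k M = digit_value k B"
  have B: "digit_value k B = 2 ^ k" by (rule digit_value_first)
  have nz: "M k \<noteq> 0"
  proof
    assume 0: "M k = 0"
    then have "k \<noteq> 0" using eq B by (cases k) auto
    then obtain k' where k': "k = Suc k'" by (cases k) auto
    have "\<bar>digit_value k' M\<bar> < 2 ^ k" using abs_digit_value_less[of k' M] M k' by simp
    then show False using eq B 0 k' by simp
  qed
  moreover have "\<bar>M k\<bar> \<le> 1" using M by simp
  ultimately have abs: "\<bar>M k\<bar> = 1" by linarith
  have "real k * D \<le> comp_time D A M k"
  proof (cases "\<exists>j<k. M j \<noteq> 0")
    case True
    then obtain j k' where "k = Suc k'" "j \<le> k'" "M j \<noteq> 0"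
      by (metis less_Suc_eq_le less_imp_Suc_add)
    then show ?thesis using comp_time_next[of M k' j D A] abs A_nonneg by simp
  next
    case False
    then show ?thesis using comp_time_first[of M k D A] abs by simp
  qed
  then show "(real k + 0) * D \<le> comp_time D A M k" by simp
qed

lemma lower_bound_Suc:
  assumes "lower_bound i d" and "k \<le> i"
  defines "d' \<equiv> if B (Suc i) = 1 then max (d - 1) 0 + \<alpha> else min (d - 1) \<alpha>"
  shows "lower_bound (Suc i) d'"
  unfolding lower_bound_def
proof (intro allI impI)
  fix M assume M: "\<forall>j\<le>Suc i. \<bar>M j\<bar> \<le> 1"
    and eq: "digit_value (Suc i) M = digit_value (Suc i) B"
  let ?p = "2 ^ Suc i :: int"
  have lt: "\<bar>digit_value i M\<bar> < ?p" using M by (intro abs_digit_value_less) simp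
  have B: "0 < digit_value i B" "digit_value i B < ?p"
    using digit_value_bits[OF assms(2)] digit_value_bits_less by auto
  have diff: "(M (Suc i) - B (Suc i)) * ?p = digit_value i B - digit_value i M"
    using eq by (simp add: algebra_simps)
  have digit: "M (Suc i) \<in> {-1, 0, 1}" using M[rule_format, of "Suc i"] by auto
  have IH: "(real i + d) * D \<le> comp_time D A M i" if "digit_value i M = digit_value i B"
    using assms(1) M that unfolding lower_bound_def by simp
  have busy: "comp_time D A M (Suc i) = max (comp_time D A M i) (real (Suc i) * D) + A"
    if "M (Suc i) \<noteq> 0"
  proof -
    \<comment> \<open>A nonzero digit pays the full \<open>A\<close> only if another one lies below
      it. With a zero prefix, a multiple of \<open>2 ^ (i + 1)\<close> would lie strictly between 0
      and \<open>2 ^ (i + 1)\<close>.\<close>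
    have "digit_value i M \<noteq> 0"
    proof
      assume "digit_value i M = 0"
      then have "(M (Suc i) - B (Suc i)) * ?p = digit_value i B" using diff by simp
      then have "0 < (M (Suc i) - B (Suc i)) * ?p" "(M (Suc i) - B (Suc i)) * ?p < 1 * ?p"
        using B by simp_all
      then show False by (simp add: zero_less_mult_iff mult_less_cancel_right del: power_Suc mult_1)
    qed
    then obtain j where "j \<le> i" "M j \<noteq> 0" using digit_value_zero by metis
    then show ?thesis using comp_time_next digit that by auto
  qed
  show "(real (Suc i) + d') * D \<le> comp_time D A M (Suc i)"
  proof (cases "B (Suc i) = 1")
    case True
    \<comment> \<open>A smaller digit would push the value of the lower prefix of \<open>M\<close>
      above \<open>2 ^ (i + 1)\<close>; so over a binary 1 the carry was already 0.\<close>
    have "M (Suc i) = 1"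
    proof (rule ccontr)
      assume "M (Suc i) \<noteq> 1"
      then have "M (Suc i) - B (Suc i) \<le> -1" using digit True by auto
      then have "(M (Suc i) - B (Suc i)) * ?p \<le> -1 * ?p" by (intro mult_right_mono) auto
      then show False using diff lt B by linarith
    qed
    then have "(real i + d) * D \<le> comp_time D A M i"
      using IH diff True by simp
    moreover have "(real (Suc i) + d') * D = max ((real i + d) * D) (real (Suc i) * D) + A"
    proof -
      have "real (Suc i) + max (d - 1) 0 = max (real i + d) (real (Suc i))" by (simp add: max_def)
      moreover have "max ((real i + d) * D) (real (Suc i) * D) = max (real i + d) (real (Suc i)) * D"
        using D by (simp add: max_mult_distrib_right)
      ultimately show ?thesis using True A by (simp add: d'_def algebra_simps)
    qed
    ultimately show ?thesis using busy \<open>M (Suc i) = 1\<close> by simp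
  next
    case False
    then have B0: "B (Suc i) = 0" using bits[of "Suc i"] by auto
    show ?thesis
    proof (cases "M (Suc i) = 0")
      case True
      \<comment> \<open>The time stands still while the index grows, hence
        \<open>d - 1\<close>.\<close>
      have "(real (Suc i) + d') * D \<le> (real i + d) * D"
        using False D by (intro mult_right_mono) (auto simp: d'_def)
      then show ?thesis using IH diff B0 True comp_time_zero[of M i D A] by simp
    next
      case nz: False
      \<comment> \<open>Nothing is assumed about the time of the lower prefix here: the delay of the
        digit itself plus \<open>A\<close> suffices.\<close>
      have "(real (Suc i) + d') * D \<le> (real (Suc i) + \<alpha>) * D"
        using False D by (intro mult_right_mono) (auto simp: d'_def)
      then show ?thesis using busy[OF nz] A by (simp add: algebra_simps)
    qed
  qed
qed

section \<open>Invariant of the algorithm and upper bound\<close>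

text \<open>The bound \<open>e \<le> 3\<close> keeps the sum bound alive when a 1 is read while
  \<open>d < 1\<close>, since then \<open>d\<close> jumps to \<alpha>.\<close>

definition switchable :: "nat \<Rightarrow> (nat \<Rightarrow> int) \<Rightarrow> nat \<Rightarrow> real \<Rightarrow> bool" where
  "switchable i m l d \<longleftrightarrow> l \<le> i \<and> m l = 1 \<and>
     (\<exists>e. comp_time D A (borrow m l) i \<le> (real i + e) * D \<and> d + e \<le> \<alpha> + 2 \<and> e \<le> 3)"

text \<open>Digits from \<open>l\<close> on are 0 or 1, so a later borrow stays within -1, 0, 1. The
  alternative \<open>l = Suc i\<close> means that no block is open; \<open>d \<le> 1\<close> then
  lets the next digit start undelayed.\<close>

definition upper_bound :: "nat \<Rightarrow> alg_state \<Rightarrow> bool" where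
  "upper_bound i = (\<lambda>(m, l, d).
     (\<forall>j>i. m j = B j) \<and> (\<forall>j<l. m j \<in> {-1, 0, 1}) \<and> (\<forall>j\<ge>l. m j \<in> {0, 1}) \<and>
     digit_value i m = digit_value i B \<and>
     comp_time D A m i \<le> (real i + d) * D \<and>
     (l = Suc i \<and> d \<le> 1 \<or> switchable i m l d))"

lemma upper_bound_first: "upper_bound k (B, k, 0)"
proof -
  \<comment> \<open>Both strings have their lowest nonzero digit at \<open>k\<close>, so
    \<open>d = e = 0\<close>.\<close>
  have "comp_time D A B k \<le> real k * D" using comp_time_first[of B k D A] first by simp
  moreover have "comp_time D A (borrow B k) k \<le> real k * D"
    using comp_time_first[of "borrow B k" k D A] first by (simp add: borrow_def)
  ultimately show ?thesis
    using bits first \<alpha> unfolding upper_bound_def switchable_def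
    by (auto intro!: exI[of _ 0])
qed

lemma switchable_Suc_one:
  assumes "switchable i m l d" and "m (Suc i) = 1"
  shows "switchable (Suc i) m l (max (d - 1) 0 + \<alpha>)"
proof -
  obtain e where l: "l \<le> i" "m l = 1" and e: "comp_time D A (borrow m l) i \<le> (real i + e) * D"
    "d + e \<le> \<alpha> + 2" "e \<le> 3"
    using assms(1) unfolding switchable_def by blast
  have "borrow m l (Suc i) = 0" using l assms(2) by (simp add: borrow_def)
  then have "comp_time D A (borrow m l) (Suc i) \<le> (real (Suc i) + (e - 1)) * D"
    using e(1) by (rule comp_time_zero_scaled)
  \<comment> \<open>For \<open>d \<ge> 1\<close> the sum is at most \<open>2 * \<alpha>\<close>,
    below \<open>\<alpha> + 2\<close>; for \<open>d < 1\<close> the bound is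
    \<open>e \<le> 3\<close>.\<close>
  moreover have "max (d - 1) 0 + \<alpha> + (e - 1) \<le> \<alpha> + 2" using e \<alpha> by linarith
  ultimately show ?thesis using l e unfolding switchable_def
    by (intro conjI exI[of _ "e - 1"]) auto
qed

lemma switchable_Suc_zero:
  assumes "switchable i m l d" and "m (Suc i) = 0" and "1 < d - 1" and "d - 1 \<le> \<alpha>"
  shows "switchable (Suc i) m l (d - 1)"
proof -
  obtain e where l: "l \<le> i" "m l = 1" and e: "comp_time D A (borrow m l) i \<le> (real i + e) * D"
    "d + e \<le> \<alpha> + 2" "e \<le> 3"
    using assms(1) unfolding switchable_def by blast
  let ?e = "max (e - 1) 0 + \<alpha>"
  have "\<bar>borrow m l (Suc i)\<bar> = 1" using l assms(2) by (simp add: borrow_def)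
  then have "comp_time D A (borrow m l) (Suc i) \<le> (real (Suc i) + ?e) * D"
    using e(1) by (rule comp_time_le_scaled)
  \<comment> \<open>For \<open>e \<ge> 1\<close> the sum is again at most
    \<open>2 * \<alpha>\<close>; for \<open>e < 1\<close> it is at most \<open>\<alpha> + 2\<close>
    because \<open>d - 1 \<le> \<alpha> < 2\<close>.\<close>
  moreover have "d - 1 + ?e \<le> \<alpha> + 2" using e \<alpha> assms by linarith
  ultimately show ?thesis using l assms \<alpha> unfolding switchable_def
    by (intro conjI exI[of _ ?e]) auto
qed

text \<open>Opens a block at a fresh 1: replacing it by -1 affects neither the digits below nor the
  cost, so \<open>d = e = \<alpha>\<close>, and
  \<open>2 * \<alpha> \<le> \<alpha> + 2\<close>.\<close>

lemma switchable_new: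
  assumes "m (Suc i) = 1" and "comp_time D A m i \<le> (real i + 1) * D"
  shows "switchable (Suc i) m (Suc i) \<alpha>"
proof -
  have "comp_time D A (borrow m (Suc i)) i = comp_time D A m i"
    by (rule comp_time_cong) (simp add: borrow_def)
  then have "comp_time D A (borrow m (Suc i)) (Suc i) \<le> (real (Suc i) + \<alpha>) * D"
    using comp_time_le_scaled[of "borrow m (Suc i)" i 1] assms by (simp add: borrow_def)
  then show ?thesis using assms \<alpha> unfolding switchable_def
    by (intro conjI exI[of _ \<alpha>]) auto
qed

lemma upper_bound_one:
  assumes "upper_bound i (m, l, d)" and "m (Suc i) = 1"
  shows "upper_bound (Suc i) (m, l, max (d - 1) 0 + \<alpha>)"
proof -
  have inv: "\<forall>j>i. m j = B j" "\<forall>j<l. m j \<in> {-1, 0, 1}" "\<forall>j\<ge>l. m j \<in> {0, 1}"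
    "digit_value i m = digit_value i B" "comp_time D A m i \<le> (real i + d) * D"
    and l: "l = Suc i \<and> d \<le> 1 \<or> switchable i m l d"
    using assms(1) unfolding upper_bound_def by auto
  have "switchable (Suc i) m l (max (d - 1) 0 + \<alpha>)"
    using l
  proof
    assume *: "l = Suc i \<and> d \<le> 1"
    then have "(real i + d) * D \<le> (real i + 1) * D" using D by (intro mult_right_mono) auto
    then show ?thesis using switchable_new[of m i] assms(2) inv(5) * by simp
  next
    assume "switchable i m l d"
    then show ?thesis using assms(2) by (rule switchable_Suc_one)
  qed
  moreover have "comp_time D A m (Suc i) \<le> (real (Suc i) + (max (d - 1) 0 + \<alpha>)) * D"
    using assms(2) inv(5) by (intro comp_time_le_scaled) simp_all
  ultimately show ?thesis using inv unfolding upper_bound_def by auto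
qed

lemma upper_bound_zero:
  assumes "upper_bound i (m, l, d)" and "m (Suc i) = 0"
    and "d - 1 \<le> \<alpha>"
  shows "upper_bound (Suc i) (m, if d - 1 \<le> 1 then Suc (Suc i) else l, d - 1)"
proof -
  have inv: "\<forall>j>i. m j = B j" "\<forall>j<l. m j \<in> {-1, 0, 1}" "\<forall>j\<ge>l. m j \<in> {0, 1}"
    "digit_value i m = digit_value i B" "comp_time D A m i \<le> (real i + d) * D"
    and l: "l = Suc i \<and> d \<le> 1 \<or> switchable i m l d"
    using assms(1) unfolding upper_bound_def by auto
  have digits: "m j \<in> {-1, 0, 1}" for j using inv(2,3) by (cases "j < l") auto
  have time: "comp_time D A m (Suc i) \<le> (real (Suc i) + (d - 1)) * D"
    using assms(2) inv(5) by (rule comp_time_zero_scaled)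
  show ?thesis
  proof (cases "d - 1 \<le> 1")
    case True
    then show ?thesis using inv digits bits time unfolding upper_bound_def by simp
  next
    case False
    then have "switchable (Suc i) m l (d - 1)"
      using l assms by (intro switchable_Suc_zero) auto
    then show ?thesis using False inv time unfolding upper_bound_def by simp
  qed
qed

lemma upper_bound_switch:
  assumes "upper_bound i (m, l, d)" and "m (Suc i) = 0" and "\<alpha> < d - 1"
    and m': "\<And>j. j \<le> i \<Longrightarrow> m' j = borrow m l j" "m' (Suc i) = 1"
      "\<And>j. Suc i < j \<Longrightarrow> m' j = m j"
  shows "upper_bound (Suc i) (m', Suc i, \<alpha>)"
proof -
  have inv: "\<forall>j>i. m j = B j" "\<forall>j<l. m j \<in> {-1, 0, 1}" "\<forall>j\<ge>l. m j \<in> {0, 1}"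
    "digit_value i m = digit_value i B"
    and "l = Suc i \<and> d \<le> 1 \<or> switchable i m l d"
    using assms(1) unfolding upper_bound_def by auto
  then have "switchable i m l d" using assms(3) \<alpha> by linarith
  then obtain e where l: "l \<le> i" "m l = 1"
    and e: "comp_time D A (borrow m l) i \<le> (real i + e) * D" "d + e \<le> \<alpha> + 2"
    unfolding switchable_def by blast
  have "(real i + e) * D \<le> (real i + 1) * D"
    using D e(2) assms(3) by (intro mult_right_mono) auto
  then have time: "comp_time D A m' i \<le> (real i + 1) * D"
    using e(1) comp_time_cong[of i m' "borrow m l" D A] m'(1) by simp
  have "digit_value i m' = digit_value i m - 2 ^ Suc i"
    using digit_value_borrow[of l i m] l digit_value_cong[of i m' "borrow m l"] m'(1) by simp
  \<comment> \<open>The new 1 at \<open>Suc i\<close> repays the borrowed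
    \<open>2 ^ (i + 1)\<close>.\<close>
  then have "digit_value (Suc i) m' = digit_value (Suc i) B"
    using m'(2) inv(1,4) assms(2) by simp
  moreover have "m' j \<in> {-1, 0, 1}" if "j < Suc i" for j
    using that m'(1)[of j] inv(2,3)[rule_format, of j] by (auto simp: borrow_def)
  moreover have "m' j \<in> {0, 1}" if "j \<ge> Suc i" for j
    using that m'(2) m'(3)[of j] inv(1) bits[of j] by (cases "j = Suc i") auto
  moreover have "comp_time D A m' (Suc i) \<le> (real (Suc i) + \<alpha>) * D"
    using comp_time_le_scaled[of m' i 1] m'(2) time by simp
  moreover have "switchable (Suc i) m' (Suc i) \<alpha>"
    using m'(2) time by (rule switchable_new)
  ultimately show ?thesis using inv(1) m'(3) unfolding upper_bound_def by simp
qed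

section \<open>Both bounds along the run of the algorithm\<close>

lemma alg3_step_bounds:
  assumes ub: "upper_bound i s" and lb: "lower_bound i (snd (snd s))" and "k \<le> i"
  shows "upper_bound (Suc i) (alg3_step \<alpha> (Suc i) s) \<and>
    lower_bound (Suc i) (snd (snd (alg3_step \<alpha> (Suc i) s)))"
proof -
  obtain m l d where s: "s = (m, l, d)" by (cases s)
  have B: "B (Suc i) = m (Suc i)" using ub s unfolding upper_bound_def by simp
  note low = lower_bound_Suc[OF lb assms(3)]
  show ?thesis
  proof (cases "m (Suc i) = 1")
    case True
    have "max (d + (\<alpha> - 1)) \<alpha> = max (d - 1) 0 + \<alpha>" by (simp add: max_def)
    then show ?thesis using upper_bound_one[of i m l d] ub low True B s
      by (simp add: alg3_step_def)
  next
    case False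
    then have m0: "m (Suc i) = 0" using B bits[of "Suc i"] by auto
    show ?thesis
    proof (cases "\<alpha> < d - 1")
      case True
      let ?m' = "\<lambda>j. if j = l then -1
                else if l < j \<and> j < Suc i then m j - 1
                else if j = Suc i then 1
                else m j"
      \<comment> \<open>Here \<open>d > 1\<close> excludes \<open>l = Suc i\<close>, so the -1 at
        \<open>l\<close> and the 1 at \<open>Suc i\<close> do not collide.\<close>
      have l: "l \<le> i" using ub True \<alpha> s unfolding upper_bound_def switchable_def by auto
      have "upper_bound (Suc i) (?m', Suc i, \<alpha>)"
        using ub m0 True l unfolding s
        by (intro upper_bound_switch[of i m l d]) (auto simp: borrow_def)
      then show ?thesis using low m0 B True s by (simp add: alg3_step_def min_def)
    next
      case False
      then have "upper_bound (Suc i) (m, if d - 1 \<le> 1 then Suc (Suc i) else l, d - 1)"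
        using ub m0 s by (intro upper_bound_zero) auto
      then show ?thesis using low m0 B False s
        by (simp add: alg3_step_def min_def Let_def split: if_splits)
    qed
  qed
qed

lemma alg3_fold_bounds:
  assumes "k \<le> i"
  defines "s \<equiv> fold (alg3_step \<alpha>) [k + 1 ..< i + 1] (B, k, 0)"
  shows "upper_bound i s \<and> lower_bound i (snd (snd s))"
  unfolding s_def using assms(1)
proof (induction i rule: dec_induct)
  case base
  then show ?case using upper_bound_first lower_bound_first by simp
next
  case (step i)
  then show ?case using alg3_step_bounds by simp
qed

end

theorem theorem5:
  fixes D A :: real and n :: int and \<nu> :: nat and N :: "nat \<Rightarrow> int"
  assumes "D > 0" and "D \<le> A" and "A < 2 * D"
    and "n > 0"
    and "binary_expansion n \<nu> N"
  shows "canonical_rep n (\<nu> + 1) (alg3 (A / D) \<nu> N) \<and>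
    (\<forall>M. canonical_rep n (\<nu> + 1) M \<longrightarrow>
       comp_time D A (alg3 (A / D) \<nu> N) (\<nu> + 1) \<le> comp_time D A M (\<nu> + 1))"
proof -
  \<comment> \<open>Padding with zeros makes the final loop round at \<open>\<nu> + 1\<close> an
    ordinary step over a binary 0.\<close>
  let ?B = "\<lambda>j. if j \<le> \<nu> then N j else 0"
  let ?k = "lowest_one \<nu> N"
  have N: "\<And>j. j \<le> \<nu> \<Longrightarrow> N j \<in> {0, 1}" "N \<nu> = 1" "digit_value \<nu> N = n"
    using assms(5) unfolding binary_expansion_def by auto
  have k: "?k \<le> \<nu>" "N ?k = 1"
    using LeastI[of "\<lambda>j. j \<le> \<nu> \<and> N j = 1" \<nu>] N(2) unfolding lowest_one_def by auto
  have least: "N j = 0" if "j < ?k" for j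
    using not_less_Least[of j "\<lambda>j. j \<le> \<nu> \<and> N j = 1"] that k(1) N(1)[of j]
    unfolding lowest_one_def by auto
  interpret add_chain D A "A / D" ?B ?k
    using assms(1-3) N(1) k least by unfold_locales (auto simp: field_simps)
  obtain m l d where s:
    "fold (alg3_step (A / D)) [?k + 1 ..< \<nu> + 2] (?B, ?k, 0) = (m, l, d)"
    by (metis prod_cases3)
  then have alg: "alg3 (A / D) \<nu> N = m" by (simp add: alg3_def alg3_init_def)
  \<comment> \<open>The same \<open>d\<close> bounds the output from above and every competitor from
    below.\<close>
  have ub: "upper_bound (\<nu> + 1) (m, l, d)" and lb: "lower_bound (\<nu> + 1) d"
    using alg3_fold_bounds[of "\<nu> + 1"] k(1) s by simp_all
  have val: "digit_value (\<nu> + 1) ?B = n"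
    using N(3) digit_value_cong[of \<nu> ?B N] by simp
  have "m j \<in> {-1, 0, 1}" for j
    using ub unfolding upper_bound_def by (cases "j < l") auto
  then have "canonical_rep n (\<nu> + 1) m"
    using ub val unfolding canonical_rep_def upper_bound_def by simp
  moreover have "comp_time D A m (\<nu> + 1) \<le> comp_time D A M (\<nu> + 1)"
    if M: "canonical_rep n (\<nu> + 1) M" for M
  proof -
    have "\<bar>M j\<bar> \<le> 1" if "j \<le> \<nu> + 1" for j
      using M that unfolding canonical_rep_def by fastforce
    moreover have "digit_value (\<nu> + 1) M = digit_value (\<nu> + 1) ?B"
      using M val unfolding canonical_rep_def by (simp only:)
    ultimately have "(real (\<nu> + 1) + d) * D \<le> comp_time D A M (\<nu> + 1)"
      using lb[unfolded lower_bound_def, rule_format, of M] by (simp only:)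
    then show ?thesis using ub unfolding upper_bound_def by simp
  qed
  ultimately show ?thesis using alg by blast
qed

end
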